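(* Let $X_{\mathbb{D}}$ be a $\mathbb{D}$-random variable on a $\mathbb{D}$-probabilistic space $(\Omega,\Sigma,P_{\mathbb{D}})$ and let $\mathbb{P}=\{A_i \mid i\in\mathbb{N}\}\subset\Sigma$ be a partition of $\Omega$ with $P_{\mathbb{D}}(A_i)\succ0$ for every $i$. If $E_{\mathbb{P}}(X_{\mathbb{D}})$ exists (where $E(|X_{\mathbb{D}}|_k)\prec\infty$, i.e. $X_{\mathbb{D}}$ is integrable), then $E_{\mathcal{A}}(X_{\mathbb{D}})$ exists for each sub-partition $\mathcal{A}=\{A_{i_n} \mid n\in\mathbb{N}\}\subset\mathbb{P}$ (with the indices $i_n$ distinct), and, with $A=\bigcup_{n=1}^\infty A_{i_n}$, $$E_{A}(X_{\mathbb{D}})\,P_{\mathbb{D}}(A)=\int_{A}E_{\mathbb{P}}(X_{\mathbb{D}})\,dP_{\mathbb{D}}=P_{\mathbb{D}}(A)\sum_{n=1}^{\infty}E_{A_{i_n}}(X_{\mathbb{D}})\,P_{\mathbb{D}}(A_{i_n}/A).$$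
   Context: The hyperbolic numbers are the commutative ring $\mathbb{D}=\{a+bk \mid a,b\in\mathbb{R},\ k^2=1,\ k\notin\mathbb{R}\}$. Put $e=\frac{1+k}{2}$, $e^{\dagger}=\frac{1-k}{2}$ (so $e^2=e$, $(e^\dagger)^2=e^\dagger$, $ee^\dagger=0$, $e+e^\dagger=1$); every $z=a+bk$ is uniquely $z=v_1e+v_2e^{\dagger}$ with $v_1=a+b$, $v_2=a-b\in\mathbb{R}$, and all algebraic operations are componentwise in $(v_1,v_2)$. The hyperbolic modulus is $|v_1e+v_2e^\dagger|_k=|v_1|e+|v_2|e^\dagger$. Let $\mathbb{D}^+=\{v_1e+v_2e^\dagger \mid v_1,v_2\ge 0\}$; write $z_1\preceq z_2$ if $z_2-z_1\in\mathbb{D}^+$, and $z_1\prec z_2$ if moreover $z_1\neq z_2$. $\mathfrak{S}_{\mathbb{D}}$ is the set of zero divisors of $\mathbb{D}$, i.e. the nonzero real multiples of $e$ and of $e^\dagger$. The topology on $\mathbb{D}$ is the usual topology of $\mathbb{R}^2$ in the coordinates $(v_1,v_2)$. A $\mathbb{D}$-probabilistic space $(\Omega,\Sigma,P_{\mathbb{D}})$ is a measurable space $(\Omega,\Sigma)$ with a function $P_{\mathbb{D}}\colon\Sigma\to\mathbb{D}$ such that $P_{\mathbb{D}}(A)\succeq 0$ for all $A\in\Sigma$, $P_{\mathbb{D}}(\Omega)\in\{1,e,e^\dagger\}$, and $P_{\mathbb{D}}$ is countably additive on pairwise disjoint sequences in $\Sigma$. Write $P_{\mathbb{D}}=P_1e+P_2e^\dagger$;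 $P_1,P_2$ are ordinary real measures on $\Sigma$ (each a probability measure or zero). A $\mathbb{D}$-random variable is a function $X_{\mathbb{D}}\colon\Omega\to\mathbb{D}$ with $X_{\mathbb{D}}^{-1}(U)\in\Sigma$ for every open $U\subset\mathbb{D}$; equivalently $X_{\mathbb{D}}=eX_1+e^\dagger X_2$ with $X_1,X_2$ real measurable functions. It is integrable if $X_1$ is Lebesgue integrable with respect to $P_1$ and $X_2$ with respect to $P_2$; then $\int_B X_{\mathbb{D}}\,dP_{\mathbb{D}}=e\int_B X_1\,dP_1+e^\dagger\int_B X_2\,dP_2$ for $B\in\Sigma$, and $E(X_{\mathbb{D}})=\int_\Omega X_{\mathbb{D}}\,dP_{\mathbb{D}}$. The conditional probability of $C\in\Sigma$ given $B\in\Sigma$ is $$P_{\mathbb{D}}(C/B)=\begin{cases}\dfrac{P_{\mathbb{D}}(C\cap B)}{P_{\mathbb{D}}(B)} & \text{if } P_{\mathbb{D}}(B)\succ0,\ P_{\mathbb{D}}(B)\notin\mathfrak{S}_{\mathbb{D}},\\[2mm] P_{\mathbb{D}}(C) & \text{if } P_{\mathbb{D}}(B)=0,\\[1mm] \dfrac{P_{\mathbb{D}}(C\cap B)}{\lambda_1}e+P_{\mathbb{D}}(C)e^\dagger & \text{if } P_{\mathbb{D}}(B)=\lambda_1e,\ \lambda_1>0,\\[2mm] P_{\mathbb{D}}(C)e+\dfrac{P_{\mathbb{D}}(C\cap B)}{\lambda_2}e^\dagger & \text{if } P_{\mathbb{D}}(B)=\lambda_2e^\dagger,\ \lambda_2>0.\end{cases}$$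 The conditional expectation of $X_{\mathbb{D}}$ given an event $B\in\Sigma$ is $$E_B(X_{\mathbb{D}})=\begin{cases}\dfrac{1}{P_{\mathbb{D}}(B)}\displaystyle\int_B X_{\mathbb{D}}\,dP_{\mathbb{D}} & \text{if } P_{\mathbb{D}}(B)\succ0,\ P_{\mathbb{D}}(B)\notin\mathfrak{S}_{\mathbb{D}},\\[2mm] E(X_{\mathbb{D}}) & \text{if } P_{\mathbb{D}}(B)=0,\\[1mm] \dfrac{1}{\lambda_1}\Big(\displaystyle\int_B X_{\mathbb{D}}\,dP_{\mathbb{D}}\Big)e+E(X_{\mathbb{D}})e^\dagger & \text{if } P_{\mathbb{D}}(B)=\lambda_1e,\ \lambda_1>0,\\[2mm] E(X_{\mathbb{D}})e+\dfrac{1}{\lambda_2}\Big(\displaystyle\int_B X_{\mathbb{D}}\,dP_{\mathbb{D}}\Big)e^\dagger & \text{if } P_{\mathbb{D}}(B)=\lambda_2e^\dagger,\ \lambda_2>0.\end{cases}$$ For $X_{\mathbb{D}}$ with $E(|X_{\mathbb{D}}|_k)\prec\infty$ (i.e. integrable), the conditional expectation given the partition $\mathbb{P}=\{A_i\mid i\in\mathbb{N}\}$ is the countably valued function $E_{\mathbb{P}}(X_{\mathbb{D}})=\sum_{i=1}^\infty E_{A_i}(X_{\mathbb{D}})\,\chi_{A_i}$ on $\Omega$, where $\chi_{A}$ is the usual $\{0,1\}$-valued indicator function of $A$; for a sub-partition $\mathcal{A}=\{A_{i_n}\mid n\in\mathbb{N}\}$ with union $A$, $E_{\mathcal{A}}(X_{\mathbb{D}})=\sum_{n=1}^\infty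 E_{A_{i_n}}(X_{\mathbb{D}})\,\chi_{A_{i_n}}$ on $A$. Existence of $E_{\mathcal{A}}(X_{\mathbb{D}})$ means that the integrals defining all the values $E_{A_{i_n}}(X_{\mathbb{D}})$, as well as $E_A(X_{\mathbb{D}})$, exist. *)

theory Defs
  imports "HOL-Analysis.Analysis"
begin

section \<open>Hyperbolic numbers\<close>

text \<open>\<open>Hyp a b\<close> is the number \<open>a + b k\<close> with \<open>k\<^sup>2 = 1\<close>.\<close>

datatype hyp = Hyp (real_part: real) (k_part: real)

text \<open>The coordinates \<open>v\<^sub>1\<close>, \<open>v\<^sub>2\<close> with respect to the idempotent basis
  (see \<open>idempotent_decomposition\<close> below).\<close>

definition comp1 :: "hyp \<Rightarrow> real" where
  "comp1 z = real_part z + k_part z"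

definition comp2 :: "hyp \<Rightarrow> real" where
  "comp2 z = real_part z - k_part z"

lemma hyp_eqI: "comp1 z = comp1 w \<Longrightarrow> comp2 z = comp2 w \<Longrightarrow> z = w"
  by (cases z; cases w) (auto simp: comp1_def comp2_def)

lemma hyp_eq_iff: "z = w \<longleftrightarrow> comp1 z = comp1 w \<and> comp2 z = comp2 w"
  by (auto intro: hyp_eqI)

instantiation hyp :: comm_ring_1
begin

definition "0 = Hyp 0 0"
definition "1 = Hyp 1 0"
definition "z + w = Hyp (real_part z + real_part w) (k_part z + k_part w)"
definition "z - w = Hyp (real_part z - real_part w) (k_part z - k_part w)"
definition "- z = Hyp (- real_part z) (- k_part z)"
definition "z * w = Hyp (real_part z * real_part w + k_part z * k_part w)
                        (real_part z * k_part w + k_part z * real_part w)"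

lemma hyp_sel:
  "real_part 0 = 0" "k_part 0 = 0" "real_part 1 = 1" "k_part 1 = 0"
  "real_part (z + w) = real_part z + real_part w" "k_part (z + w) = k_part z + k_part w"
  "real_part (z - w) = real_part z - real_part w" "k_part (z - w) = k_part z - k_part w"
  "real_part (- z) = - real_part z" "k_part (- z) = - k_part z"
  "real_part (z * w) = real_part z * real_part w + k_part z * k_part w"
  "k_part (z * w) = real_part z * k_part w + k_part z * real_part w"
  by (simp_all only: zero_hyp_def one_hyp_def plus_hyp_def minus_hyp_def uminus_hyp_def
      times_hyp_def hyp.sel)

instance
  by standard (simp_all add: hyp_eq_iff comp1_def comp2_def hyp_sel algebra_simps)

end

lemma comp_ring [simp]:
  "comp1 0 = 0" "comp2 0 = 0" "comp1 1 = 1" "comp2 1 = 1"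
  "comp1 (z + w) = comp1 z + comp1 w" "comp2 (z + w) = comp2 z + comp2 w"
  "comp1 (z - w) = comp1 z - comp1 w" "comp2 (z - w) = comp2 z - comp2 w"
  "comp1 (- z) = - comp1 z" "comp2 (- z) = - comp2 z"
  "comp1 (z * w) = comp1 z * comp1 w" "comp2 (z * w) = comp2 z * comp2 w"
  by (simp_all add: comp1_def comp2_def hyp_sel algebra_simps)

text \<open>The norm is the Euclidean norm in the coordinates \<open>(v\<^sub>1, v\<^sub>2)\<close>, so that the induced topology
  is the usual one of the plane. It is unrelated to the hyperbolic modulus \<open>\<bar>z\<bar>\<close> below.\<close>

instantiation hyp :: real_normed_vector
begin

definition "r *\<^sub>R z = Hyp (r * real_part z) (r * k_part z)"
definition "norm z = norm (comp1 z, comp2 z)"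
definition "dist z w = norm (z - w)" for z w :: hyp
definition "sgn z = inverse (norm z) *\<^sub>R z" for z :: hyp
definition "uniformity = (INF e\<in>{0<..}. principal {(x :: hyp, y). dist x y < e})"
definition "open U \<longleftrightarrow> (\<forall>x\<in>U. eventually (\<lambda>(x', y). x' = x \<longrightarrow> y \<in> U) uniformity)"
  for U :: "hyp set"

lemma comp_scaleR [simp]: "comp1 (r *\<^sub>R z) = r * comp1 z" "comp2 (r *\<^sub>R z) = r * comp2 z"
  by (simp_all add: comp1_def comp2_def scaleR_hyp_def algebra_simps)

instance
proof
  fix r s :: real and z w :: hyp
  show "r *\<^sub>R (z + w) = r *\<^sub>R z + r *\<^sub>R w" "(r + s) *\<^sub>R z = r *\<^sub>R z + s *\<^sub>R z"
    "r *\<^sub>R s *\<^sub>R z = (r * s) *\<^sub>R z" "1 *\<^sub>R z = z"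
    by (simp_all add: hyp_eq_iff algebra_simps)
  show "norm z = 0 \<longleftrightarrow> z = 0"
    by (simp add: norm_hyp_def zero_prod_def hyp_eq_iff)
  show "norm (z + w) \<le> norm z + norm w"
    using norm_triangle_ineq[of "(comp1 z, comp2 z)" "(comp1 w, comp2 w)"]
    by (simp add: norm_hyp_def)
  show "norm (r *\<^sub>R z) = \<bar>r\<bar> * norm z"
    using norm_scaleR[of r "(comp1 z, comp2 z)"]
    by (simp add: norm_hyp_def)
qed (rule dist_hyp_def sgn_hyp_def uniformity_hyp_def open_hyp_def)+

end

instance hyp :: real_algebra_1
  by standard (simp_all add: hyp_eq_iff algebra_simps)

definition hyp_k :: hyp where
  "hyp_k = Hyp 0 1"

definition idem1 :: hyp where
  "idem1 = (1/2) *\<^sub>R (1 + hyp_k)"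

definition idem2 :: hyp where
  "idem2 = (1/2) *\<^sub>R (1 - hyp_k)"

lemma comp_idem [simp]:
  "comp1 hyp_k = 1" "comp2 hyp_k = -1"
  "comp1 idem1 = 1" "comp2 idem1 = 0" "comp1 idem2 = 0" "comp2 idem2 = 1"
  by (simp_all add: idem1_def idem2_def) (simp_all add: hyp_k_def comp1_def comp2_def)

lemma idempotent_decomposition: "z = comp1 z *\<^sub>R idem1 + comp2 z *\<^sub>R idem2"
  by (simp add: hyp_eq_iff)

lemma Hyp_eq: "Hyp a b = a *\<^sub>R 1 + b *\<^sub>R hyp_k"
  by (simp add: hyp_eq_iff) (simp add: comp1_def comp2_def)

lemma idem_rules:
  "hyp_k * hyp_k = 1" "idem1 * idem1 = idem1" "idem2 * idem2 = idem2"
  "idem1 * idem2 = 0" "idem1 + idem2 = 1"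
  by (simp_all add: hyp_eq_iff)

definition hyp_nonneg :: "hyp set" where
  "hyp_nonneg = {v1 *\<^sub>R idem1 + v2 *\<^sub>R idem2 | v1 v2. v1 \<ge> 0 \<and> v2 \<ge> 0}"

lemma hyp_nonneg_iff: "z \<in> hyp_nonneg \<longleftrightarrow> comp1 z \<ge> 0 \<and> comp2 z \<ge> 0"
proof
  assume "comp1 z \<ge> 0 \<and> comp2 z \<ge> 0"
  then show "z \<in> hyp_nonneg"
    unfolding hyp_nonneg_def using idempotent_decomposition[of z] by blast
qed (auto simp: hyp_nonneg_def)

text \<open>The order is partial; \<open>z < w\<close> only requires one strict coordinate.\<close>

instantiation hyp :: order
begin

definition "z \<le> w \<longleftrightarrow> w - z \<in> hyp_nonneg"
definition "z < w \<longleftrightarrow> z \<le> w \<and> z \<noteq> w" for z w :: hyp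

instance
  by standard (auto simp: less_eq_hyp_def less_hyp_def hyp_nonneg_iff hyp_eq_iff)

end

definition zero_divisors :: "hyp set" where
  "zero_divisors = {z. z \<noteq> 0 \<and> (\<exists>w. w \<noteq> 0 \<and> z * w = 0)}"

lemma zero_divisors_eq:
  "zero_divisors = {r *\<^sub>R idem1 | r. r \<noteq> 0} \<union> {r *\<^sub>R idem2 | r. r \<noteq> 0}"
proof (intro equalityI subsetI)
  fix z assume "z \<in> zero_divisors"
  then consider "comp1 z \<noteq> 0" "comp2 z = 0" | "comp1 z = 0" "comp2 z \<noteq> 0"
    by (auto simp: zero_divisors_def hyp_eq_iff)
  then show "z \<in> {r *\<^sub>R idem1 | r. r \<noteq> 0} \<union> {r *\<^sub>R idem2 | r. r \<noteq> 0}"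
  proof cases
    case 1
    then have "z = comp1 z *\<^sub>R idem1" by (simp add: hyp_eq_iff)
    with 1 show ?thesis by blast
  next
    case 2
    then have "z = comp2 z *\<^sub>R idem2" by (simp add: hyp_eq_iff)
    with 2 show ?thesis by blast
  qed
next
  fix z assume "z \<in> {r *\<^sub>R idem1 | r. r \<noteq> 0} \<union> {r *\<^sub>R idem2 | r. r \<noteq> 0}"
  then consider r where "r \<noteq> 0" "z = r *\<^sub>R idem1" | r where "r \<noteq> 0" "z = r *\<^sub>R idem2"
    by blast
  then show "z \<in> zero_divisors"
  proof cases
    case 1
    then have "z \<noteq> 0 \<and> idem2 \<noteq> 0 \<and> z * idem2 = 0" by (simp add: hyp_eq_iff)
    then show ?thesis unfolding zero_divisors_def by blast
  next
    case 2
    then have "z \<noteq> 0 \<and> idem1 \<noteq> 0 \<and> z * idem1 = 0" by (simp add: hyp_eq_iff)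
    then show ?thesis unfolding zero_divisors_def by blast
  qed
qed

text \<open>Division is the ring division where the denominator is invertible (\<open>hyp_divide\<close>);
  elsewhere it takes a junk value.\<close>

instantiation hyp :: inverse
begin

definition "inverse z = inverse (comp1 z) *\<^sub>R idem1 + inverse (comp2 z) *\<^sub>R idem2"
definition "z div w = z * inverse w" for z w :: hyp

instance ..

end

lemma hyp_divide:
  fixes z w :: hyp
  assumes "w \<noteq> 0" "w \<notin> zero_divisors"
  shows "(z / w) * w = z"
proof -
  have "idem1 \<noteq> 0" "idem2 \<noteq> 0"
    by (simp_all add: hyp_eq_iff)
  then have "w * idem1 \<noteq> 0" "w * idem2 \<noteq> 0"
    using assms unfolding zero_divisors_def by blast+
  then have "comp1 w \<noteq> 0" "comp2 w \<noteq> 0"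
    by (simp_all add: hyp_eq_iff)
  then show ?thesis
    by (simp add: divide_hyp_def inverse_hyp_def hyp_eq_iff)
qed

instantiation hyp :: abs
begin

definition "\<bar>z\<bar> = \<bar>comp1 z\<bar> *\<^sub>R idem1 + \<bar>comp2 z\<bar> *\<^sub>R idem2"

instance ..

end

section \<open>Hyperbolic probability spaces\<close>

text \<open>The measurable space \<open>(\<Omega>, \<Sigma>)\<close> is \<open>(space M, sets M)\<close>; the measure that \<open>M\<close> carries is never used.
  The hyperbolic probability \<open>P\<close> is a total function of which only the values on \<open>sets M\<close> matter.\<close>

definition hyp_prob_space :: "'a measure \<Rightarrow> ('a set \<Rightarrow> hyp) \<Rightarrow> bool" where
  "hyp_prob_space M P \<longleftrightarrow>
     (\<forall>A\<in>sets M. 0 \<le> P A) \<and>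
     P (space M) \<in> {1, idem1, idem2} \<and>
     (\<forall>A::nat \<Rightarrow> 'a set. range A \<subseteq> sets M \<longrightarrow> disjoint_family A \<longrightarrow>
        (\<lambda>n. P (A n)) sums P (\<Union>n. A n))"

definition comp_measure1 :: "'a measure \<Rightarrow> ('a set \<Rightarrow> hyp) \<Rightarrow> 'a measure" where
  "comp_measure1 M P = measure_of (space M) (sets M) (\<lambda>A. ennreal (comp1 (P A)))"

definition comp_measure2 :: "'a measure \<Rightarrow> ('a set \<Rightarrow> hyp) \<Rightarrow> 'a measure" where
  "comp_measure2 M P = measure_of (space M) (sets M) (\<lambda>A. ennreal (comp2 (P A)))"

lemma sets_comp_measure [simp, measurable_cong]:
  "sets (comp_measure1 M P) = sets M" "sets (comp_measure2 M P) = sets M"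
  by (simp_all add: comp_measure1_def comp_measure2_def)

lemma space_comp_measure [simp]:
  "space (comp_measure1 M P) = space M" "space (comp_measure2 M P) = space M"
  by (simp_all add: comp_measure1_def comp_measure2_def)

lemma bounded_linear_comp: "bounded_linear comp1" "bounded_linear comp2"
proof -
  have "\<bar>comp1 z\<bar> \<le> norm z" "\<bar>comp2 z\<bar> \<le> norm z" for z
    using norm_fst_le[of "comp1 z" "comp2 z"] norm_snd_le[of "comp2 z" "comp1 z"]
    by (auto simp: norm_hyp_def)
  then show "bounded_linear comp1" "bounded_linear comp2"
    by (auto intro!: bounded_linear_intro[where K = 1])
qed

text \<open>The two component measures take the intended values.\<close>

lemma emeasure_comp_measure:
  assumes P: "hyp_prob_space M P" and A: "A \<in> sets M"
  shows "emeasure (comp_measure1 M P) A = ennreal (comp1 (P A))"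
    and "emeasure (comp_measure2 M P) A = ennreal (comp2 (P A))"
proof -
  have nonneg: "0 \<le> comp1 (P B)" "0 \<le> comp2 (P B)" if "B \<in> sets M" for B
    using P that by (auto simp: hyp_prob_space_def less_eq_hyp_def hyp_nonneg_iff)
  have add: "(\<lambda>n. P (B n)) sums P (\<Union>n. B n)"
    if "range B \<subseteq> sets M" "disjoint_family B" for B :: "nat \<Rightarrow> 'a set"
    using P that by (auto simp: hyp_prob_space_def)
  have "(\<lambda>n::nat. P {}) sums P {}"
    using add[of "\<lambda>_. {}"] by (simp add: disjoint_family_on_def)
  then have empty: "P {} = 0"
    by (metis sums_summable summable_const_iff)
  have ca: "countably_additive (sets M) (\<lambda>A. ennreal (f (P A)))"
    if f: "bounded_linear f" and nn: "\<And>B. B \<in> sets M \<Longrightarrow> 0 \<le> f (P B)" for f :: "hyp \<Rightarrow> real"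
  proof (rule countably_additiveI)
    fix B :: "nat \<Rightarrow> 'a set"
    assume B: "range B \<subseteq> sets M" "disjoint_family B"
    have "(\<lambda>n. f (P (B n))) sums f (P (\<Union>n. B n))"
      using bounded_linear.sums[OF f add[OF B]] .
    then show "(\<Sum>n. ennreal (f (P (B n)))) = ennreal (f (P (\<Union>n. B n)))"
      using nn B by (intro suminf_ennreal_eq) auto
  qed
  show "emeasure (comp_measure1 M P) A = ennreal (comp1 (P A))"
    unfolding comp_measure1_def
    using ca[OF bounded_linear_comp(1)] nonneg A
    by (intro emeasure_measure_of_sigma)
      (auto simp: positive_def empty sets.sigma_algebra_axioms)
  show "emeasure (comp_measure2 M P) A = ennreal (comp2 (P A))"
    unfolding comp_measure2_def
    using ca[OF bounded_linear_comp(2)] nonneg A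
    by (intro emeasure_measure_of_sigma)
      (auto simp: positive_def empty sets.sigma_algebra_axioms)
qed

section \<open>Integration\<close>

definition hyp_set_integrable :: "'a measure \<Rightarrow> ('a set \<Rightarrow> hyp) \<Rightarrow> 'a set \<Rightarrow> ('a \<Rightarrow> hyp) \<Rightarrow> bool" where
  "hyp_set_integrable M P B X \<longleftrightarrow>
     set_integrable (comp_measure1 M P) B (\<lambda>\<omega>. comp1 (X \<omega>)) \<and>
     set_integrable (comp_measure2 M P) B (\<lambda>\<omega>. comp2 (X \<omega>))"

definition hyp_set_integral :: "'a measure \<Rightarrow> ('a set \<Rightarrow> hyp) \<Rightarrow> 'a set \<Rightarrow> ('a \<Rightarrow> hyp) \<Rightarrow> hyp" where
  "hyp_set_integral M P B X =
     (LINT \<omega>:B|comp_measure1 M P. comp1 (X \<omega>)) *\<^sub>R idem1 +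
     (LINT \<omega>:B|comp_measure2 M P. comp2 (X \<omega>)) *\<^sub>R idem2"

abbreviation hyp_integrable :: "'a measure \<Rightarrow> ('a set \<Rightarrow> hyp) \<Rightarrow> ('a \<Rightarrow> hyp) \<Rightarrow> bool" where
  "hyp_integrable M P X \<equiv> hyp_set_integrable M P (space M) X"

abbreviation hyp_expectation :: "'a measure \<Rightarrow> ('a set \<Rightarrow> hyp) \<Rightarrow> ('a \<Rightarrow> hyp) \<Rightarrow> hyp" where
  "hyp_expectation M P X \<equiv> hyp_set_integral M P (space M) X"

lemma hyp_integrable_iff:
  "hyp_integrable M P X \<longleftrightarrow>
     integrable (comp_measure1 M P) (\<lambda>\<omega>. comp1 (X \<omega>)) \<and>
     integrable (comp_measure2 M P) (\<lambda>\<omega>. comp2 (X \<omega>))"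
  unfolding hyp_set_integrable_def set_integrable_def
  by (intro arg_cong2[where f = conj] Bochner_Integration.integrable_cong) auto

text \<open>Integrability of \<open>X\<close> amounts to finiteness of the expectation of the modulus.\<close>

lemma hyp_integrable_abs_iff:
  assumes "X \<in> borel_measurable M"
  shows "hyp_integrable M P X \<longleftrightarrow>
    (\<integral>\<^sup>+\<omega>. ennreal (comp1 \<bar>X \<omega>\<bar>) \<partial>comp_measure1 M P) < \<infinity> \<and>
    (\<integral>\<^sup>+\<omega>. ennreal (comp2 \<bar>X \<omega>\<bar>) \<partial>comp_measure2 M P) < \<infinity>"
proof -
  have [measurable]: "(\<lambda>\<omega>. comp1 (X \<omega>)) \<in> borel_measurable M" "(\<lambda>\<omega>. comp2 (X \<omega>)) \<in> borel_measurable M"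
    using assms bounded_linear_comp
    by (auto intro!: measurable_compose[OF assms] borel_measurable_continuous_onI
        linear_continuous_on)
  show ?thesis
    by (simp add: hyp_integrable_iff integrable_iff_bounded abs_hyp_def)
qed

section \<open>Conditional probability and conditional expectation\<close>

text \<open>In the last two cases \<open>P B = \<lambda>\<^sub>i e\<^sub>i\<close> determines \<open>\<lambda>\<^sub>i\<close> as the corresponding coordinate of \<open>P B\<close>.
  For \<open>P B \<ge> 0\<close> the four cases are exhaustive.\<close>

definition hyp_cond_prob :: "('a set \<Rightarrow> hyp) \<Rightarrow> 'a set \<Rightarrow> 'a set \<Rightarrow> hyp" where
  "hyp_cond_prob P C B =
    (if P B > 0 \<and> P B \<notin> zero_divisors then P (C \<inter> B) / P B
     else if P B = 0 then P C
     else if \<exists>r>0. P B = r *\<^sub>R idem1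
       then ((1 / comp1 (P B)) *\<^sub>R P (C \<inter> B)) * idem1 + P C * idem2
     else P C * idem1 + ((1 / comp2 (P B)) *\<^sub>R P (C \<inter> B)) * idem2)"

definition hyp_cond_exp ::
    "'a measure \<Rightarrow> ('a set \<Rightarrow> hyp) \<Rightarrow> 'a set \<Rightarrow> ('a \<Rightarrow> hyp) \<Rightarrow> hyp" where
  "hyp_cond_exp M P B X =
    (if P B > 0 \<and> P B \<notin> zero_divisors then (1 / P B) * hyp_set_integral M P B X
     else if P B = 0 then hyp_expectation M P X
     else if \<exists>r>0. P B = r *\<^sub>R idem1
       then ((1 / comp1 (P B)) *\<^sub>R hyp_set_integral M P B X) * idem1 + hyp_expectation M P X * idem2
     else hyp_expectation M P X * idem1 + ((1 / comp2 (P B)) *\<^sub>R hyp_set_integral M P B X) * idem2)"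

text \<open>All integrals occurring in the relevant case of \<open>hyp_cond_exp\<close> exist.\<close>

definition hyp_cond_exp_exists ::
    "'a measure \<Rightarrow> ('a set \<Rightarrow> hyp) \<Rightarrow> 'a set \<Rightarrow> ('a \<Rightarrow> hyp) \<Rightarrow> bool" where
  "hyp_cond_exp_exists M P B X \<longleftrightarrow>
    (if P B > 0 \<and> P B \<notin> zero_divisors then hyp_set_integrable M P B X
     else if P B = 0 then hyp_integrable M P X
     else hyp_set_integrable M P B X \<and> hyp_integrable M P X)"

definition hyp_partition :: "'a measure \<Rightarrow> (nat \<Rightarrow> 'a set) \<Rightarrow> bool" where
  "hyp_partition M A \<longleftrightarrow> range A \<subseteq> sets M \<and> disjoint_family A \<and> (\<Union>i. A i) = space M"

text \<open>The countably valued function attached to a disjoint sequence of events.\<close>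

definition hyp_cond_exp_family ::
    "'a measure \<Rightarrow> ('a set \<Rightarrow> hyp) \<Rightarrow> (nat \<Rightarrow> 'a set) \<Rightarrow> ('a \<Rightarrow> hyp) \<Rightarrow> 'a \<Rightarrow> hyp" where
  "hyp_cond_exp_family M P A X \<omega> = (\<Sum>i. hyp_cond_exp M P (A i) X * indicator (A i) \<omega>)"

definition hyp_cond_exp_family_exists ::
    "'a measure \<Rightarrow> ('a set \<Rightarrow> hyp) \<Rightarrow> (nat \<Rightarrow> 'a set) \<Rightarrow> ('a \<Rightarrow> hyp) \<Rightarrow> bool" where
  "hyp_cond_exp_family_exists M P A X \<longleftrightarrow>
     (\<forall>i. hyp_cond_exp_exists M P (A i) X) \<and> hyp_cond_exp_exists M P (\<Union>i. A i) X"

end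

theory Submission
  imports Defs
begin

text \<open>
  In each idempotent coordinate, the four-case definitions collapse to the classical quotients,
  with the unconditional value where the coordinate of \<open>P B\<close> vanishes. Since integrals over
  null sets vanish, \<open>E\<^sub>B(X) P(B) = \<integral>\<^sub>B X dP\<close> holds in every case, so everything reduces to countable
  additivity of the integral; averaging over the pieces does not increase the integral of the
  modulus, which gives integrability of \<open>E\<^sub>\<P>(X)\<close>.
\<close>

section \<open>Coordinate form of the hyperbolic notions\<close>

lemma zero_divisors_iff: "z \<in> zero_divisors \<longleftrightarrow> (comp1 z = 0) \<noteq> (comp2 z = 0)"
proof -
  have "z = comp1 z *\<^sub>R idem1" if "comp2 z = 0"
    using that by (simp add: hyp_eq_iff)
  moreover have "z = comp2 z *\<^sub>R idem2" if "comp1 z = 0"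
    using that by (simp add: hyp_eq_iff)
  ultimately show ?thesis
    unfolding zero_divisors_eq by (auto 4 3)
qed

lemma pos_multiple_idem1_iff: "(\<exists>r>0. z = r *\<^sub>R idem1) \<longleftrightarrow> comp1 z > 0 \<and> comp2 z = 0"
  by (auto simp: hyp_eq_iff)

lemma hyp_pos_iff: "0 < z \<longleftrightarrow> 0 \<le> comp1 z \<and> 0 \<le> comp2 z \<and> (comp1 z \<noteq> 0 \<or> comp2 z \<noteq> 0)"
  by (auto simp: less_hyp_def less_eq_hyp_def hyp_nonneg_iff hyp_eq_iff)

lemma hyp_nonneg_comp: "0 \<le> z \<longleftrightarrow> 0 \<le> comp1 z \<and> 0 \<le> comp2 z"
  by (simp add: less_eq_hyp_def hyp_nonneg_iff)

text \<open>No invertibility of \<open>w\<close> is assumed: \<open>inverse\<close> on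
  \<open>hyp\<close> is built from real inverses, so a vanishing coordinate of \<open>w\<close>
  gives quotient 0 in that coordinate.\<close>

lemma comp_divide [simp]:
  "comp1 (z / w) = comp1 z / comp1 w" "comp2 (z / w) = comp2 z / comp2 w" for z w :: hyp
  by (simp_all add: divide_hyp_def inverse_hyp_def field_simps)

lemma comp_hyp_set_integral [simp]:
  "comp1 (hyp_set_integral M P B X) = (LINT \<omega>:B|comp_measure1 M P. comp1 (X \<omega>))"
  "comp2 (hyp_set_integral M P B X) = (LINT \<omega>:B|comp_measure2 M P. comp2 (X \<omega>))"
  by (simp_all add: hyp_set_integral_def)

text \<open>For \<open>0 \<le> P B\<close> the four cases record which coordinates of
  \<open>P B\<close> vanish, and the factors \<open>idem1\<close>, \<open>idem2\<close> keep one
  coordinate each. Hence each coordinate of the result depends only on whether that same coordinate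
  of \<open>P B\<close> is zero.\<close>

lemma comp_hyp_cond_prob:
  assumes "0 \<le> P B"
  shows "comp1 (hyp_cond_prob P C B) =
      (if comp1 (P B) = 0 then comp1 (P C) else comp1 (P (C \<inter> B)) / comp1 (P B))"
    and "comp2 (hyp_cond_prob P C B) =
      (if comp2 (P B) = 0 then comp2 (P C) else comp2 (P (C \<inter> B)) / comp2 (P B))"
  using assms
  by (auto simp: hyp_cond_prob_def zero_divisors_iff pos_multiple_idem1_iff hyp_pos_iff
      hyp_nonneg_comp hyp_eq_iff[of "P B" 0])

lemma comp_hyp_cond_exp:
  assumes "0 \<le> P B"
  shows "comp1 (hyp_cond_exp M P B X) =
      (if comp1 (P B) = 0 then comp1 (hyp_expectation M P X)
       else comp1 (hyp_set_integral M P B X) / comp1 (P B))"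
    and "comp2 (hyp_cond_exp M P B X) =
      (if comp2 (P B) = 0 then comp2 (hyp_expectation M P X)
       else comp2 (hyp_set_integral M P B X) / comp2 (P B))"
  using assms
  by (auto simp: hyp_cond_exp_def zero_divisors_iff pos_multiple_idem1_iff hyp_pos_iff
      hyp_nonneg_comp hyp_eq_iff[of "P B" 0])

lemma hyp_set_integrable_of_hyp_integrable:
  assumes "hyp_integrable M P X" "B \<in> sets M"
  shows "hyp_set_integrable M P B X"
  using assms sets.sets_into_space[OF assms(2)] unfolding hyp_set_integrable_def
  by (auto intro: set_integrable_subset)

lemma hyp_cond_exp_existsI:
  assumes "hyp_integrable M P X" "B \<in> sets M"
  shows "hyp_cond_exp_exists M P B X"
  using assms by (simp add: hyp_cond_exp_exists_def hyp_set_integrable_of_hyp_integrable)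

text \<open>By disjointness only the term with index \<open>j\<close> survives, so the series is a
  finite sum.\<close>

lemma hyp_cond_exp_family_eq:
  assumes "disjoint_family A" "\<omega> \<in> A j"
  shows "hyp_cond_exp_family M P A X \<omega> = hyp_cond_exp M P (A j) X"
proof -
  have "(\<Sum>i. hyp_cond_exp M P (A i) X * indicator (A i) \<omega>)
      = (\<Sum>i\<in>{j}. hyp_cond_exp M P (A i) X * indicator (A i) \<omega>)"
    using assms by (intro suminf_finite) (auto simp: disjoint_family_on_def indicator_def)
  then show ?thesis
    using assms by (simp add: hyp_cond_exp_family_def)
qed

lemma comp_sums:
  assumes "(\<lambda>n. comp1 (f n)) sums comp1 s" "(\<lambda>n. comp2 (f n)) sums comp2 s"
  shows "f sums s"
proof -
  have "(\<lambda>n. comp1 (f n) *\<^sub>R idem1 + comp2 (f n) *\<^sub>R idem2)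
      sums (comp1 s *\<^sub>R idem1 + comp2 s *\<^sub>R idem2)"
    using assms by (intro sums_add sums_scaleR_left)
  then show ?thesis
    by (simp flip: idempotent_decomposition)
qed

section \<open>Real integrals over countable disjoint unions\<close>

text \<open>Integration term by term of the series of the restrictions of \<open>h\<close>.
  Integrability on the union is a conclusion, obtained from the summable absolute integrals; this
  allows an application to an averaged function known only piece by piece.\<close>

lemma
  fixes h :: "'a \<Rightarrow> real"
  assumes D: "\<And>n. D n \<in> sets N" "disjoint_family D"
    and h: "\<And>n. set_integrable N (D n) h"
    and summable: "summable (\<lambda>n. LINT \<omega>:D n|N. \<bar>h \<omega>\<bar>)"
  shows set_integrable_countable_Un: "set_integrable N (\<Union>n. D n) h"
    and sums_set_integral_countable_Un:
      "(\<lambda>n. LINT \<omega>:D n|N. h \<omega>) sums (LINT \<omega>:(\<Union>n. D n)|N. h \<omega>)"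
proof -
  \<comment> \<open>At each point at most one term is nonzero. The value \<open>u\<close> is
    arbitrary because it serves for both \<open>h \<omega>\<close> and its absolute value.\<close>
  have pieces: "(\<lambda>n. indicator (D n) \<omega> *\<^sub>R u) sums (indicator (\<Union>n. D n) \<omega> *\<^sub>R u)"
    for \<omega> and u :: real
  proof (cases "\<exists>j. \<omega> \<in> D j")
    case True
    then obtain j where j: "\<omega> \<in> D j" by blast
    then have "\<omega> \<in> D n \<longleftrightarrow> n = j" for n
      using D(2) by (auto simp: disjoint_family_on_def)
    then have "(\<lambda>n. indicator (D n) \<omega> *\<^sub>R u) = (\<lambda>n. if n = j then u else 0)"
      by (simp add: fun_eq_iff indicator_def)
    then show ?thesis
      using True sums_single[of j "\<lambda>_. u"] by (auto simp: indicator_def)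
  qed (auto simp: indicator_def)
  have limit: "(\<lambda>\<omega>. \<Sum>n. indicator (D n) \<omega> *\<^sub>R h \<omega>) = (\<lambda>\<omega>. indicator (\<Union>n. D n) \<omega> *\<^sub>R h \<omega>)"
    using sums_unique[OF pieces] by (simp add: fun_eq_iff)
  have int: "integrable N (\<lambda>\<omega>. indicator (D n) \<omega> *\<^sub>R h \<omega>)" for n
    using h by (simp add: set_integrable_def)
  have AE: "AE \<omega> in N. summable (\<lambda>n. norm (indicator (D n) \<omega> *\<^sub>R h \<omega>))"
    using sums_summable[OF pieces] by (simp add: abs_mult)
  have norms: "summable (\<lambda>n. \<integral>\<omega>. norm (indicator (D n) \<omega> *\<^sub>R h \<omega>) \<partial>N)"
    using summable by (simp add: set_lebesgue_integral_def abs_mult)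
  show "set_integrable N (\<Union>n. D n) h"
    using integrable_suminf[OF int AE norms] unfolding limit set_integrable_def .
  show "(\<lambda>n. LINT \<omega>:D n|N. h \<omega>) sums (LINT \<omega>:(\<Union>n. D n)|N. h \<omega>)"
    using sums_integral[OF int AE norms] unfolding limit set_lebesgue_integral_def .
qed

text \<open>The partial sums are integrals of the modulus over finite unions, hence bounded by its
  integral over the whole space.\<close>

lemma summable_set_integral_abs:
  fixes f :: "'a \<Rightarrow> real"
  assumes f: "integrable N f" and D: "\<And>n::nat. D n \<in> sets N" "disjoint_family D"
  shows "summable (\<lambda>n. LINT \<omega>:D n|N. \<bar>f \<omega>\<bar>)"
proof (rule summableI_nonneg_bounded)
  have int: "set_integrable N B (\<lambda>\<omega>. \<bar>f \<omega>\<bar>)" if "B \<in> sets N" for B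
    using integrable_mult_indicator[OF that integrable_abs[OF f]] by (simp add: set_integrable_def)
  show "0 \<le> (LINT \<omega>:D n|N. \<bar>f \<omega>\<bar>)" for n
    by (simp add: set_lebesgue_integral_def)
  show "(\<Sum>k<n. LINT \<omega>:D k|N. \<bar>f \<omega>\<bar>) \<le> (\<integral>\<omega>. \<bar>f \<omega>\<bar> \<partial>N)" for n
  proof -
    have disj: "disjoint_family_on D {..<n}"
      using D(2) by (auto simp: disjoint_family_on_def)
    have "(\<Sum>k<n. LINT \<omega>:D k|N. \<bar>f \<omega>\<bar>) = (LINT \<omega>:(\<Union>k<n. D k)|N. \<bar>f \<omega>\<bar>)"
      using disj D(1) int by (intro set_integral_finite_Union[symmetric]) auto
    also have "\<dots> \<le> (\<integral>\<omega>. \<bar>f \<omega>\<bar> \<partial>N)"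
      unfolding set_lebesgue_integral_def
      using int[of "\<Union>k<n. D k"] D(1) f
      by (intro integral_mono) (auto simp: set_integrable_def indicator_def)
    finally show ?thesis .
  qed
qed

text \<open>The classical statement for one coordinate: \<open>c n\<close> is the mean of
  \<open>f\<close> over \<open>D n\<close>, and \<open>g\<close> is the resulting step function. The
  mean is given in multiplied form, so that on a null piece \<open>c n\<close> may be any
  number.\<close>

lemma
  fixes f g :: "'a \<Rightarrow> real" and c :: "nat \<Rightarrow> real"
  assumes f: "integrable N f"
    and D: "\<And>n. D n \<in> sets N" "disjoint_family D"
    and fin: "\<And>n. emeasure N (D n) < \<infinity>"
    and c: "\<And>n. c n * measure N (D n) = (LINT \<omega>:D n|N. f \<omega>)"
    and g: "\<And>n \<omega>. \<omega> \<in> D n \<Longrightarrow> g \<omega> = c n"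
  shows set_integrable_averaged: "set_integrable N (\<Union>n. D n) g"
    and set_integral_averaged: "(LINT \<omega>:(\<Union>n. D n)|N. g \<omega>) = (LINT \<omega>:(\<Union>n. D n)|N. f \<omega>)"
    and sums_set_integral_averaged:
      "(\<lambda>n. c n * measure N (D n)) sums (LINT \<omega>:(\<Union>n. D n)|N. f \<omega>)"
proof -
  have f_D: "set_integrable N (D n) f" for n
    using integrable_mult_indicator[OF D(1) f] by (simp add: set_integrable_def)
  have abs_f: "summable (\<lambda>n. LINT \<omega>:D n|N. \<bar>f \<omega>\<bar>)"
    by (rule summable_set_integral_abs[OF f D])
  have f_sums: "(\<lambda>n. LINT \<omega>:D n|N. f \<omega>) sums (LINT \<omega>:(\<Union>n. D n)|N. f \<omega>)"
    by (rule sums_set_integral_countable_Un[OF D f_D abs_f])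
  then show "(\<lambda>n. c n * measure N (D n)) sums (LINT \<omega>:(\<Union>n. D n)|N. f \<omega>)"
    by (simp add: c)
  have const: "(LINT \<omega>:D n|N. b) = b * measure N (D n)" for n and b :: real
    using D(1) fin by (simp add: set_lebesgue_integral_def)
  have g_int: "(LINT \<omega>:D n|N. g \<omega>) = (LINT \<omega>:D n|N. f \<omega>)" for n
  proof -
    have "(LINT \<omega>:D n|N. g \<omega>) = (LINT \<omega>:D n|N. c n)"
      using D(1) g by (intro set_lebesgue_integral_cong) auto
    then show ?thesis by (simp add: const c)
  qed
  have "set_integrable N (D n) (\<lambda>_. c n)" for n
    using D(1) fin by (simp add: set_integrable_def)
  then have g_D: "set_integrable N (D n) g" for n
    using D(1) g by (subst set_integrable_cong[of N N "D n" "D n" g "\<lambda>_. c n"]) auto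
  \<comment> \<open>Since \<open>g\<close> is constant on \<open>D n\<close>, its absolute integral
    there is the modulus of the integral of \<open>f\<close>. This is where averaging is seen to
    contract, so summability passes from \<open>f\<close> to \<open>g\<close>.\<close>
  have "(LINT \<omega>:D n|N. \<bar>g \<omega>\<bar>) = \<bar>LINT \<omega>:D n|N. f \<omega>\<bar>" for n
  proof -
    have "(LINT \<omega>:D n|N. \<bar>g \<omega>\<bar>) = (LINT \<omega>:D n|N. \<bar>c n\<bar>)"
      using D(1) g by (intro set_lebesgue_integral_cong) auto
    then show ?thesis by (simp add: const abs_mult flip: c)
  qed
  moreover have "\<bar>LINT \<omega>:D n|N. f \<omega>\<bar> \<le> (LINT \<omega>:D n|N. \<bar>f \<omega>\<bar>)" for n
    using set_integral_norm_bound[OF f_D] by simp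
  ultimately have abs_g: "summable (\<lambda>n. LINT \<omega>:D n|N. \<bar>g \<omega>\<bar>)"
    by (intro summable_comparison_test'[OF abs_f]) simp
  show "set_integrable N (\<Union>n. D n) g"
    by (rule set_integrable_countable_Un[OF D g_D abs_g])
  have "(\<lambda>n. LINT \<omega>:D n|N. g \<omega>) sums (LINT \<omega>:(\<Union>n. D n)|N. g \<omega>)"
    by (rule sums_set_integral_countable_Un[OF D g_D abs_g])
  then show "(LINT \<omega>:(\<Union>n. D n)|N. g \<omega>) = (LINT \<omega>:(\<Union>n. D n)|N. f \<omega>)"
    using f_sums by (simp add: g_int sums_unique2)
qed

section \<open>Assembly of the two coordinates\<close>

theorem theorem8p3:
  fixes M :: "'a measure" and P :: "'a set \<Rightarrow> hyp" and X :: "'a \<Rightarrow> hyp"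
    and \<A> :: "nat \<Rightarrow> 'a set" and i :: "nat \<Rightarrow> nat"
  assumes "hyp_prob_space M P"
    and "X \<in> borel_measurable M"
    and "hyp_partition M \<A>"
    and "\<And>j. P (\<A> j) > 0"
    and "hyp_integrable M P X"
    and "hyp_cond_exp_family_exists M P \<A> X"
    and "inj i"
    and "A = (\<Union>n. \<A> (i n))"
  shows "hyp_cond_exp_family_exists M P (\<lambda>n. \<A> (i n)) X \<and>
    hyp_set_integrable M P A (hyp_cond_exp_family M P \<A> X) \<and>
    hyp_cond_exp M P A X * P A = hyp_set_integral M P A (hyp_cond_exp_family M P \<A> X) \<and>
    summable (\<lambda>n. hyp_cond_exp M P (\<A> (i n)) X * hyp_cond_prob P (\<A> (i n)) A) \<and>
    hyp_set_integral M P A (hyp_cond_exp_family M P \<A> X) =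
      P A * (\<Sum>n. hyp_cond_exp M P (\<A> (i n)) X * hyp_cond_prob P (\<A> (i n)) A)"
proof -
  let ?N1 = "comp_measure1 M P" and ?N2 = "comp_measure2 M P"
  let ?g = "hyp_cond_exp_family M P \<A> X"
  let ?D = "\<lambda>n. \<A> (i n)"
  let ?E = "\<lambda>B. hyp_cond_exp M P B X"
  have \<A>: "\<A> j \<in> sets M" "disjoint_family \<A>" for j
    using assms(3) by (auto simp: hyp_partition_def)
  \<comment> \<open>Injectivity of \<open>i\<close> prevents a piece from occurring twice, which
    would destroy disjointness.\<close>
  have D: "?D n \<in> sets M" "disjoint_family ?D" for n
    using \<A> \<open>inj i\<close> by (auto simp: disjoint_family_on_def inj_eq)
  have A: "A \<in> sets M"
    using D assms(8) by auto
  have nonneg: "0 \<le> P B" if "B \<in> sets M" for B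
    using assms(1) that by (simp add: hyp_prob_space_def)
  have comp_nonneg: "0 \<le> comp1 (P B)" "0 \<le> comp2 (P B)" if "B \<in> sets M" for B
    using nonneg[OF that] by (simp_all add: hyp_nonneg_comp)
  note emeasure = emeasure_comp_measure[OF assms(1)]
  have measure: "measure ?N1 B = comp1 (P B)" "measure ?N2 B = comp2 (P B)" if "B \<in> sets M" for B
    using that by (simp_all add: measure_def emeasure comp_nonneg)
  have fin: "emeasure ?N1 (?D n) < \<infinity>" "emeasure ?N2 (?D n) < \<infinity>" for n
    using D by (simp_all add: emeasure)
  have X: "integrable ?N1 (\<lambda>\<omega>. comp1 (X \<omega>))" "integrable ?N2 (\<lambda>\<omega>. comp2 (X \<omega>))"
    using assms(5) by (simp_all add: hyp_integrable_iff)
  have null: "(LINT \<omega>:B|N. f \<omega>) = 0"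
    if "emeasure N B = 0" "B \<in> sets N" for B and N :: "'a measure" and f :: "'a \<Rightarrow> real"
  proof -
    have "AE \<omega> in N. \<omega> \<notin> B"
      using that by (intro AE_not_in) (auto simp: null_sets_def)
    then show ?thesis
      unfolding set_lebesgue_integral_def by (intro integral_eq_zero_AE) auto
  qed
  \<comment> \<open>In a coordinate where \<open>P B\<close> is zero, the left side vanishes
    whatever value the conditional expectation takes there, and \<open>null\<close> makes the right
    side vanish.\<close>
  have average: "?E B * P B = hyp_set_integral M P B X" if B: "B \<in> sets M" for B
    using B null[of ?N1 B] null[of ?N2 B]
    by (auto simp: hyp_eq_iff comp_hyp_cond_exp nonneg emeasure)
  have average1: "comp1 (?E (?D n)) * measure ?N1 (?D n) = (LINT \<omega>:?D n|?N1. comp1 (X \<omega>))"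
    and average2: "comp2 (?E (?D n)) * measure ?N2 (?D n) = (LINT \<omega>:?D n|?N2. comp2 (X \<omega>))" for n
    using average[OF D(1)[of n]] D(1)[of n] by (simp_all add: hyp_eq_iff measure)
  have g: "?g \<omega> = ?E (?D n)" if "\<omega> \<in> ?D n" for n \<omega>
    by (rule hyp_cond_exp_family_eq[OF \<A>(2) that])
  have D1: "?D n \<in> sets ?N1" and D2: "?D n \<in> sets ?N2" for n
    using D by simp_all
  have g1: "comp1 (?g \<omega>) = comp1 (?E (?D n))" and g2: "comp2 (?g \<omega>) = comp2 (?E (?D n))"
    if "\<omega> \<in> ?D n" for n \<omega>
    using g[OF that] by simp_all
  \<comment> \<open>The hypotheses of the averaging lemma in each coordinate, with
    \<open>c n\<close> the coordinate of \<open>?E (?D n)\<close> and \<open>g\<close> that of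
    \<open>?g\<close>.\<close>
  note avg1 = X(1) D1 D(2) fin(1) average1 g1
  note avg2 = X(2) D2 D(2) fin(2) average2 g2
  have exist: "hyp_cond_exp_family_exists M P ?D X"
    using assms(5) A D(1) assms(8)
    by (simp add: hyp_cond_exp_family_exists_def hyp_cond_exp_existsI)
  have g_integrable: "hyp_set_integrable M P A ?g"
    using set_integrable_averaged[OF avg1] set_integrable_averaged[OF avg2]
    unfolding hyp_set_integrable_def assms(8) by (rule conjI)
  have g_integral: "hyp_set_integral M P A ?g = hyp_set_integral M P A X"
    using set_integral_averaged[OF avg1] set_integral_averaged[OF avg2]
    unfolding hyp_set_integral_def assms(8) by simp
  have terms: "(\<lambda>n. ?E (?D n) * P (?D n)) sums hyp_set_integral M P A X"
    using sums_set_integral_averaged[OF avg1] sums_set_integral_averaged[OF avg2] D(1)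
    by (intro comp_sums) (simp_all add: measure assms(8))
  have sub: "?D n \<inter> A = ?D n" for n
    using assms(8) by auto
  \<comment> \<open>Monotonicity lets a vanishing coordinate of \<open>P A\<close> pass to every
    piece of \<open>A\<close>.\<close>
  have emeasure_sub: "emeasure N (?D n) \<le> emeasure N A" if "sets N = sets M"
    for n and N :: "'a measure"
    using that A assms(8) by (intro emeasure_mono) auto
  have zero1: "comp1 (P (?D n)) = 0" if "comp1 (P A) = 0" for n
    using emeasure_sub[of ?N1 n] that A D(1)[of n] comp_nonneg[OF D(1)[of n]]
    by (simp add: emeasure)
  have zero2: "comp2 (P (?D n)) = 0" if "comp2 (P A) = 0" for n
    using emeasure_sub[of ?N2 n] that A D(1)[of n] comp_nonneg[OF D(1)[of n]]
    by (simp add: emeasure)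
  \<comment> \<open>Where a coordinate of \<open>P A\<close> vanishes, the definition returns that
    coordinate of \<open>P (?D n)\<close>, which is 0 by \<open>zero1\<close> or
    \<open>zero2\<close>; this agrees with the convention that division by 0 gives 0. One formula
    thus covers all four cases.\<close>
  have cond: "hyp_cond_prob P (?D n) A = P (?D n) / P A" for n
    using A by (auto simp: hyp_eq_iff comp_hyp_cond_prob nonneg sub zero1 zero2)
  \<comment> \<open>Dividing \<open>terms\<close> by \<open>P A\<close> coordinatewise is legitimate
    even at a zero coordinate, where every quotient is 0.\<close>
  have "(\<lambda>n. comp1 (?E (?D n) * P (?D n)) / comp1 (P A)) sums
      (comp1 (hyp_set_integral M P A X) / comp1 (P A))"
    by (intro sums_divide bounded_linear.sums[OF bounded_linear_comp(1) terms])
  moreover have "(\<lambda>n. comp2 (?E (?D n) * P (?D n)) / comp2 (P A)) sums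
      (comp2 (hyp_set_integral M P A X) / comp2 (P A))"
    by (intro sums_divide bounded_linear.sums[OF bounded_linear_comp(2) terms])
  ultimately have weighted:
    "(\<lambda>n. ?E (?D n) * hyp_cond_prob P (?D n) A) sums (hyp_set_integral M P A X / P A)"
    by (intro comp_sums) (simp_all add: cond)
  \<comment> \<open>The quotient is junk in the coordinates where \<open>P A\<close> vanishes, but there the integral
    vanishes too.\<close>
  have "P A * (hyp_set_integral M P A X / P A) = hyp_set_integral M P A X"
    unfolding average[OF A, symmetric] by (simp add: hyp_eq_iff)
  then show ?thesis
    using exist g_integrable g_integral average[OF A] sums_summable[OF weighted]
      sums_unique[OF weighted] by simp
qed

end
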